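(* Let $X$ be a nonempty Hausdorff space and let $A(X)$ be a subring of $F(X)$ such that for every $f\in A(X)$: $f$ is a unit of $A(X)$ if and only if $Z(f)=\emptyset$. A proper ideal $I$ in $A(X)$ is not pseudofixed if and only if for every compact subset $Y$ of $X$ there exists $f\in I$ such that $\overline{Z(f)}\cap Y=\emptyset$.
   Context: $F(X)$ is the ring of all functions $X\to\mathbb{R}$ with pointwise operations. For $f\in F(X)$, $Z(f)=\{x\in X: f(x)=0\}$; the bar denotes closure in $X$. A proper ideal $I$ of $A(X)$ is pseudofixed if $\bigcap_{f\in I}\overline{Z(f)}\neq\emptyset$. *)

theory Defs
  imports "HOL-Analysis.Analysis" "HOL-Algebra.Subrings"
begin

definition function_ring :: "('a \<Rightarrow> real) ring" where
  "function_ring =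
    \<lparr>carrier = UNIV,
     monoid.mult = (\<lambda>f g x. f x * g x), one = (\<lambda>x. 1),
     zero = (\<lambda>x. 0), add = (\<lambda>f g x. f x + g x)\<rparr>"

lemma cring_function_ring: "cring (function_ring :: ('a \<Rightarrow> real) ring)"
proof (rule cringI)
  show "abelian_group (function_ring :: ('a \<Rightarrow> real) ring)"
  proof (rule abelian_groupI)
    fix f :: "'a \<Rightarrow> real"
    have "(\<lambda>x. - f x + f x) = (\<lambda>x. 0)" by simp
    then show "\<exists>g\<in>carrier function_ring. g \<oplus>\<^bsub>function_ring\<^esub> f = \<zero>\<^bsub>function_ring\<^esub>"
      unfolding function_ring_def by (intro bexI[of _ "\<lambda>x. - f x"]) auto
  qed (auto simp: function_ring_def fun_eq_iff algebra_simps)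
  show "comm_monoid (function_ring :: ('a \<Rightarrow> real) ring)"
    by (rule comm_monoidI) (auto simp: function_ring_def fun_eq_iff algebra_simps)
qed (auto simp: function_ring_def fun_eq_iff algebra_simps)

text \<open>A subring \<open>A\<close> of \<open>function_ring\<close>, viewed as a ring in its own right.\<close>

abbreviation subring_of_functions :: "('a \<Rightarrow> real) set \<Rightarrow> ('a \<Rightarrow> real) ring" where
  "subring_of_functions A \<equiv> function_ring\<lparr>carrier := A\<rparr>"

definition zero_set :: "('a \<Rightarrow> real) \<Rightarrow> 'a set" where
  "zero_set f = {x. f x = 0}"

definition proper_ideal :: "'r set \<Rightarrow> ('r, 'm) ring_scheme \<Rightarrow> bool" where
  "proper_ideal I R \<longleftrightarrow> ideal I R \<and> I \<noteq> carrier R"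

text \<open>Only meant for proper ideals of a ring of functions.\<close>

definition pseudofixed :: "('a::topological_space \<Rightarrow> real) set \<Rightarrow> bool" where
  "pseudofixed I \<longleftrightarrow> (\<Inter>f\<in>I. closure (zero_set f)) \<noteq> {}"

end

theory Submission
  imports Defs
begin

text \<open>
  Since a sum of squares vanishes exactly where all the summands do, every finite
  intersection of zero sets of members of the ideal is again such a zero set. Hence, if the
  closed sets \<open>closure (zero_set f)\<close>, for \<open>f\<close> in the ideal, have empty intersection, the finite
  intersection property on \<open>Y\<close> yields a single \<open>f\<close> whose closed zero set misses \<open>Y\<close>.
  Conversely, singletons are compact.
\<close>

lemma ideal_zero_set_INT:
  assumes I: "ideal I (subring_of_functions A)" and "finite F" and "F \<subseteq> I"
  shows "\<exists>h\<in>I. zero_set h = (\<Inter>f\<in>F. zero_set f)"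
  using \<open>finite F\<close> \<open>F \<subseteq> I\<close>
proof (induction F rule: finite_induct)
  case empty
  \<comment> \<open>The empty intersection is the whole space, which is the zero set of the zero
    function.\<close>
  have "(\<lambda>x. 0) \<in> I"
    using additive_subgroup.zero_closed[OF ideal.axioms(1)[OF I]] by (simp add: function_ring_def)
  then show ?case
    by (auto simp: zero_set_def)
next
  case (insert g F)
  then obtain h where h: "h \<in> I" "zero_set h = (\<Inter>f\<in>F. zero_set f)"
    by auto
  \<comment> \<open>Absorption applies with \<open>f\<close> itself as the multiplier, since
    \<open>I\<close> lies inside \<open>A\<close>.\<close>
  have square: "(\<lambda>x. f x * f x) \<in> I" if "f \<in> I" for f
    using ideal.I_l_closed[OF I that] ideal.Icarr[OF I that] by (simp add: function_ring_def)
  have "g \<in> I"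
    using insert.prems by simp
  then have "(\<lambda>x. g x * g x + h x * h x) \<in> I"
    using additive_subgroup.a_closed[OF ideal.axioms(1)[OF I] square square] h(1)
    by (simp add: function_ring_def)
  moreover have "zero_set (\<lambda>x. g x * g x + h x * h x) = zero_set g \<inter> zero_set h"
    by (auto simp: zero_set_def)
  ultimately show ?case
    using h(2) by (metis INT_insert)
qed

theorem theorem3p12:
  fixes A I :: "('a::t2_space \<Rightarrow> real) set"
  assumes "subring A function_ring"
    and "\<And>f. f \<in> A \<Longrightarrow> f \<in> Units (subring_of_functions A) \<longleftrightarrow> zero_set f = {}"
    and "proper_ideal I (subring_of_functions A)"
  shows "\<not> pseudofixed I \<longleftrightarrow>
    (\<forall>Y::'a set. compact Y \<longrightarrow> (\<exists>f\<in>I. closure (zero_set f) \<inter> Y = {}))"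
proof (intro iffI allI impI)
  fix Y :: "'a set"
  assume "\<not> pseudofixed I" "compact Y"
  have I: "ideal I (subring_of_functions A)"
    using assms(3) by (simp add: proper_ideal_def)
  have "Y \<inter> (\<Inter>f\<in>I. closure (zero_set f)) = {}"
    using \<open>\<not> pseudofixed I\<close> by (simp add: pseudofixed_def)
  then obtain F where F: "finite F" "F \<subseteq> I" "Y \<inter> (\<Inter>f\<in>F. closure (zero_set f)) = {}"
    using compact_imp_fip_image[OF \<open>compact Y\<close>, of I "\<lambda>f. closure (zero_set f)"] by auto
  obtain h where "h \<in> I" and h: "zero_set h = (\<Inter>f\<in>F. zero_set f)"
    using ideal_zero_set_INT[OF I F(1,2)] by blast
  \<comment> \<open>Closure need not commute with intersection, but this inclusion suffices: the
    larger set already misses \<open>Y\<close>.\<close>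
  have "closure (zero_set h) \<subseteq> (\<Inter>f\<in>F. closure (zero_set f))"
    unfolding h by (intro INT_greatest closure_mono INT_lower)
  then show "\<exists>f\<in>I. closure (zero_set f) \<inter> Y = {}"
    using F(3) \<open>h \<in> I\<close> by blast
next
  assume *: "\<forall>Y::'a set. compact Y \<longrightarrow> (\<exists>f\<in>I. closure (zero_set f) \<inter> Y = {})"
  have "\<exists>f\<in>I. x \<notin> closure (zero_set f)" for x
    using *[rule_format, of "{x}"] by simp
  then show "\<not> pseudofixed I"
    unfolding pseudofixed_def by blast
qed

end
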